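(* Let $\mathbf{a}=(a_1,a_2,\ldots,a_n)$ denote the content of a Fubini ranking with $k\leq a_1\leq n-k+1$. Let $F_{n,k}(\mathbf{a})$ be the number of weakly flattened Fubini rankings of length $n$ with content $\mathbf{a}$ which have $k$ runs of weak ascents and also end in the value $1$. Then $$F_{n,k}(\mathbf{a})=\binom{a_1-1}{k-1}\cdot|\mathcal{B}_k(\mathbf{a})|,$$ where $\mathcal{B}_k(\mathbf{a})$ is the set of $n\times(k-1)$ nonnegative integer valued matrices whose $i$th row is a weak composition of $a_i$ and whose column sums are always greater than or equal to $1$.
   Context: Let $[n]=\{1,2,\ldots,n\}$. A Fubini ranking of length $n$ is a tuple $r=(r_1,\ldots,r_n)\in[n]^n$ that records a valid ranking of $n$ competitors with ties allowed, where if $t$ competitors are tied and rank $i$th, then the $t-1$ subsequent ranks $i+1,\ldots,i+t-1$ are disallowed; equivalently, $r_i=1+|\{j : r_j<r_i\}|$ for every $i\in[n]$. The content of a Fubini ranking of length $n$ is the tuple $(a_1,\ldots,a_n)$ where $a_i$ is the number of competitors with rank $i$, that is, the number of entries equal to $i$. A run of weak ascents of a word $w=w_1\cdots w_n$ is a maximal contiguous subword $w_iw_{i+1}\cdots w_j$ with $w_l\le w_{l+1}$ for all $i\le l\le j-1$. Here a Fubini ranking is weakly flattened if the leading (first) terms of its runs of weak ascents, read from left to right, are in weakly increasing order. A weak composition of $m$ is a tuple of nonnegative integers with sum $m$; the rows of the matrices above are weak compositions with $k-1$ parts.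
   Formalization: The matrices in B_k(a) have n-1 rows, one for each of a_2,...,a_n, instead of n rows including one for a_1 (with it the identity fails, e.g. n=5, k=3, a=(3,0,0,2,0): 1 versus 10); k≥1 is stated explicitly. *)

theory Defs
  imports Complex_Main "Jordan_Normal_Form.Matrix"
begin

text \<open>Tuples and words are lists indexed from 0: the paper's $r_{i+1}$ is \<open>r ! i\<close>.  The entries
  of a ranking are the ranks $1, \dots, n$ themselves, with no shift.\<close>

definition fubini_ranking :: "nat \<Rightarrow> nat list \<Rightarrow> bool" where
  "fubini_ranking n r \<longleftrightarrow>
     length r = n \<and> set r \<subseteq> {1..n} \<and>
     (\<forall>i<n. r ! i = 1 + card {j. j < n \<and> r ! j < r ! i})"

definition content :: "nat \<Rightarrow> nat list \<Rightarrow> nat list" where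
  "content n r = map (count_list r) [1..<n + 1]"

text \<open>The pair \<open>(i, j)\<close> stands for the nonempty contiguous subword at positions
  \<open>i, \<dots>, j\<close>, both ends included.\<close>

definition weakly_ascending :: "nat list \<Rightarrow> nat \<times> nat \<Rightarrow> bool" where
  "weakly_ascending w = (\<lambda>(i, j). i \<le> j \<and> j < length w \<and>
     (\<forall>l. i \<le> l \<and> l < j \<longrightarrow> w ! l \<le> w ! (l + 1)))"

definition runs :: "nat list \<Rightarrow> (nat \<times> nat) set" where
  "runs w = {(i, j). weakly_ascending w (i, j) \<and>
     (\<forall>i' j'. weakly_ascending w (i', j') \<and> i' \<le> i \<and> j \<le> j' \<longrightarrow> i' = i \<and> j' = j)}"

definition weakly_flattened :: "nat list \<Rightarrow> bool" where
  "weakly_flattened w \<longleftrightarrow>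
     (\<forall>(i, j) \<in> runs w. \<forall>(i', j') \<in> runs w. i \<le> i' \<longrightarrow> w ! i \<le> w ! i')"

definition flattened_rankings_ending_1 :: "nat \<Rightarrow> nat \<Rightarrow> nat list \<Rightarrow> nat list set" where
  "flattened_rankings_ending_1 n k a =
     {r. fubini_ranking n r \<and> content n r = a \<and> weakly_flattened r \<and>
         card (runs r) = k \<and> r \<noteq> [] \<and> last r = 1}"

definition F :: "nat \<Rightarrow> nat \<Rightarrow> nat list \<Rightarrow> nat" where
  "F n k a = card (flattened_rankings_ending_1 n k a)"

definition weak_composition :: "nat \<Rightarrow> nat vec \<Rightarrow> bool" where
  "weak_composition m v \<longleftrightarrow> (\<Sum>j<dim_vec v. v $ j) = m"

definition composition_matrices :: "nat \<Rightarrow> nat list \<Rightarrow> nat mat set" where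
  "composition_matrices k b =
     {M \<in> carrier_mat (length b) (k - 1).
        (\<forall>i<length b. weak_composition (b ! i) (row M i)) \<and>
        (\<forall>j<k - 1. (\<Sum>i<length b. M $$ (i, j)) \<ge> 1)}"

text \<open>For the content \<open>a\<close> of a ranking the relevant set is \<open>composition_matrices k (tl a)\<close>, with
  one row for each of the ranks $2, \dots, n$: row $i$ records how the competitors of rank $i$ are
  distributed over the first $k - 1$ runs, and the last run consists of 1s only.  The paper prints
  $n$ rows.  With a row for rank 1 the identity fails: for \<open>a = [3, 0, 0, 2, 0]\<close> and \<open>k = 3\<close> the
  only ranking counted is 14141, but there are 10 matrices with row sums \<open>a\<close> and positive column
  sums, and the binomial coefficient is 1.\<close>

end

theory Submission
  imports Defs "HOL-Library.Multiset"
begin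

text \<open>
  A run starts at the initial position and after every strict descent, and nowhere else.  If a
  word of positive letters ends in 1 and the leading terms of its runs increase weakly, then the
  leading term of the last run is at most 1, and so all leading terms equal 1; in particular the
  last run consists of 1s only.  A weakly flattened word with \<open>k\<close> runs that ends in 1 therefore
  has a unique factorisation
  \[ 1^{c_1} X_1\, 1^{c_2} X_2 \cdots 1^{c_{k-1}} X_{k-1}\, 1^{c_k}, \]
  in which every \<open>c\<^sub>i\<close> is positive and every \<open>X\<^sub>i\<close> is a nonempty weakly increasing word without
  1s, in other words a nonempty multiset of ranks greater than 1.  All such factorisations occur:
  whether a word is a Fubini ranking depends only on the multiset of its letters, so a word
  with the content of one ranking is itself a ranking.

  The two kinds of data are independent.  The \<open>c\<^sub>i\<close> form a composition of \<open>a\<^sub>1\<close> into \<open>k\<close> positive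
  parts, which accounts for the binomial coefficient; the multiplicities of the ranks in the
  \<open>X\<^sub>j\<close> form a matrix whose row sums are the parts \<open>a\<^sub>2, \<dots>, a\<^sub>n\<close> of the content and whose
  columns are nonzero.  The
  factorisation is \<open>bij_betw_word_of\<close>, the count of compositions is \<open>card_compositions\<close>,
  and the matrices appear in \<open>card_multiset_lists_eq_card_matrices\<close>.
\<close>

section \<open>Runs and descents\<close>

definition run_starts :: "nat list \<Rightarrow> nat set" where
  "run_starts w = {i. i < length w \<and> (i = 0 \<or> w ! i < w ! (i - 1))}"

fun descents :: "nat list \<Rightarrow> nat" where
  "descents (x # y # w) = (if y < x then 1 else 0) + descents (y # w)"
| "descents w = 0"

text \<open>A run extends from its start as far as possible, so it is determined by its start; it
  cannot be extended to the left exactly when its start is 0 or follows a descent.\<close>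

lemma bij_betw_fst_runs: "bij_betw fst (runs w) (run_starts w)"
  unfolding bij_betw_def
proof
  show "inj_on fst (runs w)"
  proof (rule inj_onI)
    fix p q assume p: "p \<in> runs w" and q: "q \<in> runs w" and eq: "fst p = fst q"
    obtain i j j' where pq: "p = (i, j)" "q = (i, j')" using eq by (cases p, cases q) auto
    have "j = j'"
      using p q unfolding pq runs_def mem_Collect_eq prod.case by (metis nle_le order_refl)
    then show "p = q" using pq by simp
  qed
  show "fst ` runs w = run_starts w"
  proof
    show "fst ` runs w \<subseteq> run_starts w"
    proof
      fix i assume "i \<in> fst ` runs w"
      then obtain j where ij: "(i, j) \<in> runs w" by auto
      have asc: "weakly_ascending w (i, j)"
        and mx: "\<And>i' j'. weakly_ascending w (i', j') \<Longrightarrow> i' \<le> i \<Longrightarrow> j \<le> j' \<Longrightarrow> i' = i"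
        using ij unfolding runs_def by auto
      show "i \<in> run_starts w"
      proof (rule ccontr)
        assume "i \<notin> run_starts w"
        then have i: "i > 0" "w ! (i - 1) \<le> w ! i"
          using asc unfolding run_starts_def weakly_ascending_def by auto
        have "weakly_ascending w (i - 1, j)"
          unfolding weakly_ascending_def prod.case
        proof (intro conjI allI impI)
          fix l assume l: "i - 1 \<le> l \<and> l < j"
          show "w ! l \<le> w ! (l + 1)"
          proof (cases "l = i - 1")
            case True then show ?thesis using i by simp
          next
            case False
            then have "i \<le> l" using l i(1) by linarith
            then show ?thesis using asc l unfolding weakly_ascending_def by auto
          qed
        qed (use asc in \<open>auto simp: weakly_ascending_def\<close>)
        from mx[OF this] i show False by simp
      qed
    qed
    show "run_starts w \<subseteq> fst ` runs w"
    proof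
      fix i assume i: "i \<in> run_starts w"
      let ?J = "{j. weakly_ascending w (i, j)}"
      have fin: "finite ?J"
        by (rule finite_subset[of _ "{..<length w}"]) (auto simp: weakly_ascending_def)
      have "i \<in> ?J" using i unfolding run_starts_def weakly_ascending_def by auto
      then have J: "Max ?J \<in> ?J" using Max_in[OF fin] by blast
      have "(i, Max ?J) \<in> runs w"
        unfolding runs_def mem_Collect_eq prod.case
      proof (intro conjI allI impI)
        show "weakly_ascending w (i, Max ?J)" using J by simp
        fix i' j' assume h: "weakly_ascending w (i', j') \<and> i' \<le> i \<and> Max ?J \<le> j'"
        have ij: "i \<le> j'" using J h unfolding weakly_ascending_def by auto
        show i': "i' = i"
        proof (rule ccontr)
          assume "i' \<noteq> i"
          then have "i' \<le> i - 1" "i > 0" "i - 1 < j'" using h ij by auto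
          then have "w ! (i - 1) \<le> w ! (i - 1 + 1)"
            using h unfolding weakly_ascending_def by blast
          then show False using i \<open>i > 0\<close> unfolding run_starts_def by auto
        qed
        have "j' \<le> Max ?J" using h i' by (intro Max_ge[OF fin]) auto
        then show "j' = Max ?J" using h by simp
      qed
      then show "i \<in> fst ` runs w" by force
    qed
  qed
qed

lemma card_descent_positions: "card {i. Suc i < length w \<and> w ! Suc i < w ! i} = descents w"
proof (induction w rule: descents.induct)
  case (1 x y w)
  let ?A = "{i. Suc i < length (y # w) \<and> (y # w) ! Suc i < (y # w) ! i}"
  have fin: "finite ?A" by (rule finite_subset[of _ "{..<length (y # w)}"]) auto
  have "{i. Suc i < length (x # y # w) \<and> (x # y # w) ! Suc i < (x # y # w) ! i} =
        (if y < x then {0} else {}) \<union> Suc ` ?A" (is "?B = ?C")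
  proof (rule Set.set_eqI)
    fix i
    show "i \<in> ?B \<longleftrightarrow> i \<in> ?C" by (cases i) (auto simp: image_iff)
  qed
  then show ?case using 1 fin by (simp add: card_image card_insert_if)
qed auto

lemma card_runs:
  assumes "w \<noteq> []"
  shows "card (runs w) = Suc (descents w)"
proof -
  have "card (runs w) = card (run_starts w)"
    using bij_betw_same_card[OF bij_betw_fst_runs] .
  also have "run_starts w = insert 0 (Suc ` {i. Suc i < length w \<and> w ! Suc i < w ! i})" 
    (is "_ = insert 0 (Suc ` ?A)")
  proof
    show "run_starts w \<subseteq> insert 0 (Suc ` ?A)"
    proof
      fix i assume "i \<in> run_starts w"
      then show "i \<in> insert 0 (Suc ` ?A)" by (cases i) (auto simp: run_starts_def)
    qed
  qed (use assms in \<open>auto simp: run_starts_def\<close>)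
  also have "card \<dots> = Suc (card ?A)"
  proof -
    have "finite ?A" by (rule finite_subset[of _ "{..<length w}"]) auto
    then show ?thesis by (simp add: card_image)
  qed
  finally show ?thesis by (simp add: card_descent_positions)
qed

lemma weakly_flattened_iff_run_starts:
  "weakly_flattened w \<longleftrightarrow>
     (\<forall>i \<in> run_starts w. \<forall>i' \<in> run_starts w. i \<le> i' \<longrightarrow> w ! i \<le> w ! i')"
proof -
  have "run_starts w = fst ` runs w"
    using bij_betw_fst_runs[of w] unfolding bij_betw_def by simp
  then show ?thesis unfolding weakly_flattened_def by fastforce
qed

text \<open>The letter at the start of the run containing a given position is a lower bound for the
  letter at that position.\<close>

lemma obtain_run_start:
  "l < length w \<Longrightarrow>
     \<exists>i \<in> run_starts w. i \<le> l \<and> w ! i \<le> w ! l \<and> (\<forall>i' \<in> run_starts w. i' \<le> l \<longrightarrow> i' \<le> i)"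
proof (induction l)
  case 0
  then show ?case by (intro bexI[of _ 0]) (auto simp: run_starts_def)
next
  case (Suc l)
  show ?case
  proof (cases "Suc l \<in> run_starts w")
    case True
    then show ?thesis by blast
  next
    case False
    then have le: "w ! l \<le> w ! Suc l" using Suc.prems by (auto simp: run_starts_def)
    obtain i where i: "i \<in> run_starts w" "i \<le> l" "w ! i \<le> w ! l"
        "\<forall>i' \<in> run_starts w. i' \<le> l \<longrightarrow> i' \<le> i"
      using Suc by auto
    have "\<forall>i' \<in> run_starts w. i' \<le> Suc l \<longrightarrow> i' \<le> i"
      using i(4) False le_Suc_eq by auto
    then show ?thesis using i le by (intro bexI[of _ i]) auto
  qed
qed

text \<open>When the last letter is the least possible one, the last run starts with it too, and this
  bounds all the earlier leading terms from above.\<close>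

lemma weakly_flattened_iff_descents_to_1:
  assumes "w \<noteq> []" "last w = 1" "0 \<notin> set w"
  shows "weakly_flattened w \<longleftrightarrow> hd w = 1 \<and> successively (\<lambda>x y. x \<le> y \<or> y = 1) w"
proof
  assume flat: "weakly_flattened w"
  have one: "w ! i = 1" if i: "i \<in> run_starts w" for i
  proof -
    have il: "i \<le> length w - 1" using i by (auto simp: run_starts_def)
    obtain i0 where i0: "i0 \<in> run_starts w" "w ! i0 \<le> w ! (length w - 1)" "i \<le> i0"
      using obtain_run_start[of "length w - 1" w] assms(1) i il by auto
    have "w ! i \<le> w ! i0"
      using flat i i0 unfolding weakly_flattened_iff_run_starts by blast
    also have "\<dots> \<le> 1" using i0 assms by (simp add: last_conv_nth)
    finally have "w ! i \<le> 1" .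
    moreover have "w ! i \<noteq> 0"
      using i assms(3) unfolding run_starts_def by (metis (no_types, lifting) mem_Collect_eq nth_mem)
    ultimately show ?thesis by simp
  qed
  have "hd w = 1" using one[of 0] assms(1) by (simp add: run_starts_def hd_conv_nth)
  moreover have "successively (\<lambda>x y. x \<le> y \<or> y = 1) w"
    unfolding successively_conv_nth
  proof (intro allI impI)
    fix i assume i: "Suc i < length w"
    show "w ! i \<le> w ! Suc i \<or> w ! Suc i = 1"
    proof (cases "w ! Suc i < w ! i")
      case True
      then show ?thesis using one[of "Suc i"] i by (simp add: run_starts_def)
    qed simp
  qed
  ultimately show "hd w = 1 \<and> successively (\<lambda>x y. x \<le> y \<or> y = 1) w" by simp
next
  assume h: "hd w = 1 \<and> successively (\<lambda>x y. x \<le> y \<or> y = 1) w"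
  have "w ! i = 1" if i: "i \<in> run_starts w" for i
  proof (cases i)
    case 0
    then show ?thesis using h assms(1) by (simp add: hd_conv_nth)
  next
    case (Suc l)
    then have "w ! l \<le> w ! Suc l \<or> w ! Suc l = 1"
      using h i unfolding successively_conv_nth run_starts_def by auto
    then show ?thesis using i Suc by (auto simp: run_starts_def)
  qed
  then show "weakly_flattened w" unfolding weakly_flattened_iff_run_starts by simp
qed

lemma descents_append:
  "u \<noteq> [] \<Longrightarrow> v \<noteq> [] \<Longrightarrow>
     descents (u @ v) = descents u + (if hd v < last u then 1 else 0) + descents v"
proof (induction u rule: descents.induct)
  case ("2_2" x)
  then show ?case by (cases v) auto
qed auto

lemma descents_sorted: "sorted u \<Longrightarrow> descents u = 0"
  by (induction u rule: descents.induct) auto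

section \<open>Factorisation into blocks of 1s and sorted blocks\<close>

definition flat_words :: "nat list set" where
  "flat_words = {w. w \<noteq> [] \<and> hd w = 1 \<and> last w = 1 \<and> 0 \<notin> set w \<and>
     successively (\<lambda>x y. x \<le> y \<or> y = 1) w}"

text \<open>The word \<open>1\<^sup>c X 1\<^sup>d Y \<dots>\<close> with given exponents and given multisets of letters in the blocks
  between the 1s.\<close>

fun word_of :: "nat list \<Rightarrow> nat multiset list \<Rightarrow> nat list" where
  "word_of (c # cs) (X # Xs) = replicate c 1 @ sorted_list_of_multiset X @ word_of cs Xs"
| "word_of (c # cs) [] = replicate c 1"
| "word_of [] Xs = []"

text \<open>The exponents and multisets of a factorisation; there is one more block of 1s than there
  are multisets, since the word begins and ends with 1s.\<close>

definition block_data :: "nat list \<Rightarrow> nat multiset list \<Rightarrow> bool" where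
  "block_data cs Xs \<longleftrightarrow> length cs = Suc (length Xs) \<and> 0 \<notin> set cs \<and>
     (\<forall>X \<in> set Xs. X \<noteq> {#} \<and> 0 \<notin># X \<and> 1 \<notin># X)"

lemma block_data_Cons:
  "block_data (c # cs) (X # Xs) \<longleftrightarrow>
     c > 0 \<and> X \<noteq> {#} \<and> 0 \<notin># X \<and> 1 \<notin># X \<and> block_data cs Xs"
  by (auto simp: block_data_def)

lemma block_data_induct [consumes 1, case_names last step]:
  assumes "block_data cs Xs"
    and "\<And>c. c > 0 \<Longrightarrow> P [c] []"
    and "\<And>c cs X Xs. c > 0 \<Longrightarrow> X \<noteq> {#} \<Longrightarrow> 0 \<notin># X \<Longrightarrow> 1 \<notin># X \<Longrightarrow> block_data cs Xs \<Longrightarrow>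
           P cs Xs \<Longrightarrow> P (c # cs) (X # Xs)"
  shows "P cs Xs"
  using assms(1)
proof (induction Xs arbitrary: cs)
  case Nil
  then obtain c where cs: "cs = [c]" by (cases cs) (auto simp: block_data_def)
  then have "c > 0" using Nil by (simp add: block_data_def)
  then show ?case unfolding cs by (rule assms(2))
next
  case (Cons X Xs)
  then obtain c cs' where cs: "cs = c # cs'" by (cases cs) (auto simp: block_data_def)
  have "c > 0" "X \<noteq> {#}" "0 \<notin># X" "1 \<notin># X" "block_data cs' Xs"
    using Cons.prems unfolding cs block_data_Cons by blast+
  then show ?case unfolding cs by (intro assms(3) Cons.IH)
qed

lemma mset_word_of:
  "block_data cs Xs \<Longrightarrow> mset (word_of cs Xs) = replicate_mset (sum_list cs) 1 + sum_list Xs"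
  by (induction rule: block_data_induct) (auto simp: multiset_eq_iff)

lemma sorted_list_of_multiset_eq_Nil_iff [simp]: "sorted_list_of_multiset X = [] \<longleftrightarrow> X = {#}"
  by (metis mset_sorted_list_of_multiset mset_zero_iff)

text \<open>The only descents are those from the end of a sorted block to the following 1, which
  exist because the sorted blocks are nonempty.\<close>

lemma word_of_flat:
  "block_data cs Xs \<Longrightarrow> word_of cs Xs \<in> flat_words \<and> descents (word_of cs Xs) = length Xs"
proof (induction rule: block_data_induct)
  case (last c)
  have "successively (\<lambda>x y. x \<le> y \<or> y = 1) (replicate c (1::nat))"
    by (auto simp: successively_conv_nth)
  then show ?case using last by (auto simp: flat_words_def descents_sorted)
next
  case (step c cs X Xs)
  let ?s = "sorted_list_of_multiset X" and ?v = "word_of cs Xs"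
  have s: "?s \<noteq> []" using step by simp
  have gt: "x > 1" if "x \<in> set ?s" for x
    using that step(3,4) by (cases "x = 0"; cases "x = 1") auto
  have hs: "hd ?s > 1" "last ?s > 1" using gt[OF hd_in_set[OF s]] gt[OF last_in_set[OF s]] .
  have v: "?v \<noteq> []" "hd ?v = 1" "last ?v = 1" "0 \<notin> set ?v"
      "successively (\<lambda>x y. x \<le> y \<or> y = 1) ?v" "descents ?v = length Xs"
    using step.IH by (auto simp: flat_words_def)
  have "successively (\<lambda>x y. x \<le> y \<or> y = 1) (replicate c (1::nat))"
    by (auto simp: successively_conv_nth)
  moreover have "successively (\<lambda>x y. x \<le> y \<or> y = 1) ?s"
    using sorted_sorted_list_of_multiset[of X]
    by (auto intro: successively_mono[OF successively_if_sorted_wrt])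
  ultimately have "successively (\<lambda>x y. x \<le> y \<or> y = 1) (replicate c 1 @ ?s @ ?v)"
    using hs v s step(1) by (auto simp: successively_append_iff)
  moreover have "descents (replicate c 1 @ ?s @ ?v) = Suc (length Xs)"
    using step(1) s v hs by (simp add: descents_append descents_sorted)
  ultimately show ?case
    using step v s by (auto simp: flat_words_def)
qed

lemma append_eq_append_separated:
  assumes "\<forall>x \<in> set u. P x" "\<forall>x \<in> set u'. P x"
    and "v = [] \<or> \<not> P (hd v)" "v' = [] \<or> \<not> P (hd v')"
    and "u @ v = u' @ v'"
  shows "u = u' \<and> v = v'"
proof -
  have tw: "takeWhile P (y @ z) = y" if "\<forall>x \<in> set y. P x" "z = [] \<or> \<not> P (hd z)" for y z
    using that by (cases z) auto
  have "u = u'" using tw[OF assms(1,3)] tw[OF assms(2,4)] assms(5) by metis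
  then show ?thesis using assms(5) by simp
qed

text \<open>The factorisation can be read off from left to right: the blocks are maximal sequences of
  letters that all equal 1 or all differ from 1.\<close>

lemma word_of_inj:
  "block_data cs Xs \<Longrightarrow> block_data ds Ys \<Longrightarrow> word_of cs Xs = word_of ds Ys \<Longrightarrow>
     cs = ds \<and> Xs = Ys"
proof (induction arbitrary: ds Ys rule: block_data_induct)
  case (last c)
  from last(2) have "length Ys = descents (word_of ds Ys)" using word_of_flat by simp
  also have "\<dots> = 0" using last(3) by (metis word_of.simps(2) descents_sorted sorted_replicate)
  finally have "Ys = []" by simp
  moreover obtain d where "ds = [d]"
    using last(2) \<open>Ys = []\<close> by (cases ds) (auto simp: block_data_def)
  ultimately show ?case using last(3) by simp
next
  case (step c cs X Xs)
  have "length Ys = Suc (length Xs)"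
    using word_of_flat[of "c # cs" "X # Xs"] word_of_flat[OF step.prems(1)] step
    by (simp add: block_data_Cons)
  \<comment> \<open>Equal words have equally many descents, so \<open>Ys\<close> has as many blocks as \<open>X # Xs\<close>.\<close>
  then obtain Y Ys' where Y: "Ys = Y # Ys'" by (cases Ys) auto
  obtain d ds' where d: "ds = d # ds'"
    using step.prems(1) by (cases ds) (auto simp: block_data_def)
  have Y': "d > 0" "Y \<noteq> {#}" "1 \<notin># Y" "block_data ds' Ys'"
    using step.prems(1) unfolding Y d block_data_Cons by auto
  let ?s = sorted_list_of_multiset
  have hd: "hd (?s X) \<noteq> 1" "hd (?s Y) \<noteq> 1"
    using step Y' hd_in_set[of "?s X"] hd_in_set[of "?s Y"] by auto
  have 1: "replicate c 1 = replicate d (1::nat) \<and> ?s X @ word_of cs Xs = ?s Y @ word_of ds' Ys'"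
    by (rule append_eq_append_separated[where P = "\<lambda>x. x = 1"])
       (use step Y d Y' hd in auto)
  have 2: "?s X = ?s Y \<and> word_of cs Xs = word_of ds' Ys'"
    by (rule append_eq_append_separated[where P = "\<lambda>x. x \<noteq> 1"])
       (use 1 step Y' word_of_flat[of cs Xs] word_of_flat[of ds' Ys'] in \<open>auto simp: flat_words_def\<close>)
  have "c = d" using 1 by (metis length_replicate)
  moreover have "X = Y" using 2 by (metis mset_sorted_list_of_multiset)
  moreover have "cs = ds' \<and> Xs = Ys'" using step.IH[OF Y'(4)] 2 by simp
  ultimately show ?case using Y d by simp
qed

text \<open>Within a block of letters other than 1 no descent is possible, because a flat word
  descends to 1 only; so the block is sorted and is determined by its multiset.\<close>

lemma word_of_surj:
  "w \<in> flat_words \<Longrightarrow> \<exists>cs Xs. block_data cs Xs \<and> word_of cs Xs = w"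
proof (induction w rule: length_induct)
  case (1 w)
  let ?R = "\<lambda>x y. x \<le> y \<or> y = (1::nat)"
  have w: "w \<noteq> []" "hd w = 1" "last w = 1" "0 \<notin> set w" "successively ?R w"
    using "1.prems" by (auto simp: flat_words_def)
  define p where "p = takeWhile (\<lambda>x. x = 1) w"
  define u where "u = dropWhile (\<lambda>x. x = 1) w"
  define s where "s = takeWhile (\<lambda>x. x \<noteq> 1) u"
  define v where "v = dropWhile (\<lambda>x. x \<noteq> 1) u"
  have wpu: "w = p @ u" and usv: "u = s @ v" by (auto simp: p_def u_def s_def v_def)
  have p1: "\<forall>x \<in> set p. x = 1" by (auto simp: p_def dest: set_takeWhileD)
  have p: "p = replicate (length p) 1"
    using p1 by (metis replicate_length_same)
  have pne: "length p > 0" using w unfolding p_def by (cases w) auto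
  show ?case
  proof (cases "u = []")
    case True
    then show ?thesis using p pne wpu by (intro exI[of _ "[length p]"] exI[of _ "[]"]) (auto simp: block_data_def)
  next
    case u: False
    have lu: "last u = 1" using w u wpu by simp
    have "hd u \<noteq> 1" using u hd_dropWhile[of "\<lambda>x. x = 1" w] unfolding u_def by simp
    then have sne: "s \<noteq> []" unfolding s_def using u by (cases u) auto
    have s1: "1 \<notin> set s" by (auto simp: s_def dest: set_takeWhileD)
    have vne: "v \<noteq> []" using lu s1 sne usv by (metis append_Nil2 last_in_set)
    have hv: "hd v = 1" using vne hd_dropWhile[of "\<lambda>x. x \<noteq> 1" u] unfolding v_def by simp
    have "successively ?R v" and ss: "successively ?R s"
      using w(5) unfolding wpu usv by (auto simp: successively_append_iff)
    then have "v \<in> flat_words"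
      using vne hv lu w(4) wpu usv by (auto simp: flat_words_def)
    moreover have "length v < length w" using wpu usv pne by simp
    ultimately obtain cs Xs where cX: "block_data cs Xs" "word_of cs Xs = v" using "1.IH" by blast
    have "successively (\<le>) s" using ss s1 by (auto intro: successively_mono)
    then have "sorted s" by (simp add: successively_conv_sorted_wrt)
    then have sl: "sorted_list_of_multiset (mset s) = s" by (simp add: sorted_sort_id)
    have "block_data (length p # cs) (mset s # Xs)"
      using pne sne s1 w(4) wpu usv cX by (auto simp: block_data_Cons)
    moreover have "word_of (length p # cs) (mset s # Xs) = w"
      using sl cX p wpu usv by simp
    ultimately show ?thesis by blast
  qed
qed

definition compositions :: "nat \<Rightarrow> nat \<Rightarrow> nat list set" where
  "compositions k m = {cs. length cs = k \<and> 0 \<notin> set cs \<and> sum_list cs = m}"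

definition multiset_lists :: "nat \<Rightarrow> nat multiset \<Rightarrow> nat multiset list set" where
  "multiset_lists q A = {Xs. length Xs = q \<and> {#} \<notin> set Xs \<and> sum_list Xs = A}"

lemma bij_betw_word_of:
  assumes "0 \<notin># N"
  shows "bij_betw (\<lambda>(cs, Xs). word_of cs Xs)
           (compositions (Suc q) (count N 1) \<times> multiset_lists q (filter_mset (\<lambda>x. x \<noteq> 1) N))
           {w \<in> flat_words. mset w = N \<and> descents w = q}"
proof -
  let ?A = "filter_mset (\<lambda>x. x \<noteq> 1) N"
  let ?D = "compositions (Suc q) (count N 1) \<times> multiset_lists q ?A"
  have N: "replicate_mset (count N 1) 1 + ?A = N" by (auto simp: multiset_eq_iff)
  have bd: "block_data cs Xs" if "(cs, Xs) \<in> ?D" for cs Xs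
  proof -
    have "sum_list Xs = ?A" using that by (simp add: multiset_lists_def)
    then have "(\<Union>X \<in> set Xs. set_mset X) = set_mset ?A" by (metis set_mset_sum_list)
    then have "0 \<notin># X \<and> 1 \<notin># X" if "X \<in> set Xs" for X using that assms by auto
    then show ?thesis
      using that by (auto simp: block_data_def compositions_def multiset_lists_def)
  qed
  show ?thesis
    unfolding bij_betw_def
  proof
    show "inj_on (\<lambda>(cs, Xs). word_of cs Xs) ?D"
    proof (rule inj_onI)
      fix p p' assume p: "p \<in> ?D" "p' \<in> ?D"
        and eq: "(\<lambda>(cs, Xs). word_of cs Xs) p = (\<lambda>(cs, Xs). word_of cs Xs) p'"
      obtain cs Xs ds Ys where pp: "p = (cs, Xs)" "p' = (ds, Ys)" by (cases p, cases p')
      have "cs = ds \<and> Xs = Ys"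
        using word_of_inj[OF bd bd] p eq unfolding pp prod.case by blast
      then show "p = p'" using pp by simp
    qed
    show "(\<lambda>(cs, Xs). word_of cs Xs) ` ?D = {w \<in> flat_words. mset w = N \<and> descents w = q}"
    proof (intro subset_antisym subsetI)
      fix w assume "w \<in> (\<lambda>(cs, Xs). word_of cs Xs) ` ?D"
      then obtain cs Xs where c: "(cs, Xs) \<in> ?D" "w = word_of cs Xs" by auto
      have "mset w = N"
        using c(1) N unfolding c(2) mset_word_of[OF bd[OF c(1)]]
        by (simp add: compositions_def multiset_lists_def)
      then show "w \<in> {w \<in> flat_words. mset w = N \<and> descents w = q}"
        using word_of_flat[OF bd[OF c(1)]] c by (auto simp: multiset_lists_def)
    next
      fix w assume w: "w \<in> {w \<in> flat_words. mset w = N \<and> descents w = q}"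
      then obtain cs Xs where c: "block_data cs Xs" "word_of cs Xs = w"
        using word_of_surj by blast
      have m: "N = replicate_mset (sum_list cs) 1 + sum_list Xs"
        using mset_word_of[OF c(1)] c(2) w by simp
      have no1: "1 \<notin># sum_list Xs" using c(1) by (auto simp: block_data_def)
      have "sum_list cs = count N 1"
        using no1[unfolded not_in_iff] unfolding m by simp
      moreover have "filter_mset (\<lambda>x. x \<noteq> 1) (sum_list Xs) = sum_list Xs"
        using no1 by (intro filter_mset_eq_conv[THEN iffD2]) auto
      then have "sum_list Xs = ?A" unfolding m by simp
      moreover have "length Xs = q" using word_of_flat[OF c(1)] c(2) w by simp
      ultimately have "(cs, Xs) \<in> ?D"
        using c(1) by (auto simp: block_data_def compositions_def multiset_lists_def)
      then show "w \<in> (\<lambda>(cs, Xs). word_of cs Xs) ` ?D" using c(2) by force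
    qed
  qed
qed

section \<open>Counting the two kinds of data\<close>

text \<open>Subtracting 1 from every part reduces this to the count of weak compositions.\<close>

lemma card_compositions:
  assumes "1 \<le> k" "k \<le> m"
  shows "card (compositions k m) = (m - 1) choose (k - 1)"
proof -
  let ?W = "{l :: nat list. length l = k \<and> sum_list l = m - k}"
  have sum_Suc: "sum_list (map Suc l) = sum_list l + length l" for l by (induction l) auto
  have "compositions k m = map Suc ` ?W"
  proof (intro subset_antisym subsetI)
    fix cs assume cs: "cs \<in> compositions k m"
    have eq: "map Suc (map (\<lambda>x. x - 1) cs) = cs"
      using cs by (auto simp: compositions_def intro!: map_idI) (metis Suc_pred gr0I)
    have "map (\<lambda>x. x - 1) cs \<in> ?W"
      using cs sum_Suc[of "map (\<lambda>x. x - 1) cs"] unfolding eq by (auto simp: compositions_def)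
    then show "cs \<in> map Suc ` ?W" using eq by (metis imageI)
  qed (use assms in \<open>auto simp: compositions_def sum_Suc\<close>)
  then have "card (compositions k m) = card ?W" by (simp add: card_image inj_on_def)
  also have "\<dots> = (m - k + k - 1) choose (m - k)" by (rule card_length_sum_list)
  also have "\<dots> = (m - 1) choose (k - 1)"
    using assms binomial_symmetric[of "m - k" "m - 1"] by simp
  finally show ?thesis .
qed

lemma count_sum_list_nth: "count (sum_list Xs) x = (\<Sum>j<length Xs. count (Xs ! j) x)"
  by (induction Xs rule: rev_induct) (auto simp: nth_append)

text \<open>Column \<open>j\<close> of the matrix lists the multiplicities of the ranks in the \<open>j\<close>th multiset.
  Row 0 belongs to rank 2, whence the shift.\<close>

lemma card_multiset_lists_eq_card_matrices:
  assumes supp: "set_mset A \<subseteq> {2..<length b + 2}"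
    and cnt: "\<And>i. i < length b \<Longrightarrow> count A (i + 2) = b ! i"
  shows "card (multiset_lists (k - 1) A) = card (composition_matrices k b)"
proof -
  let ?m = "length b" and ?q = "k - 1"
  let ?f = "\<lambda>Xs. mat ?m ?q (\<lambda>(i, j). count (Xs ! j) (i + 2))"
  have elem: "2 \<le> x \<and> x < ?m + 2" if "Xs \<in> multiset_lists ?q A" "X \<in> set Xs" "x \<in># X" for Xs X x
  proof -
    have "set_mset A = (\<Union>X \<in> set Xs. set_mset X)"
      using that(1) unfolding multiset_lists_def by (metis (mono_tags) mem_Collect_eq set_mset_sum_list)
    then have "x \<in># A" using that by auto
    then show ?thesis using supp by auto
  qed
  have "bij_betw ?f (multiset_lists ?q A) (composition_matrices k b)"
    unfolding bij_betw_def
  proof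
    show "inj_on ?f (multiset_lists ?q A)"
    proof (rule inj_onI)
      fix Xs Ys assume X: "Xs \<in> multiset_lists ?q A" and Y: "Ys \<in> multiset_lists ?q A"
        and eq: "?f Xs = ?f Ys"
      have len: "length Xs = ?q" "length Ys = ?q" using X Y by (auto simp: multiset_lists_def)
      show "Xs = Ys"
      proof (rule nth_equalityI)
        show "length Xs = length Ys" using len by simp
        fix j assume j: "j < length Xs"
        show "Xs ! j = Ys ! j"
        proof (rule multiset_eqI)
          fix x
          show "count (Xs ! j) x = count (Ys ! j) x"
          proof (cases "2 \<le> x \<and> x < ?m + 2")
            case True
            define i where "i = x - 2"
            have "x = i + 2" "i < ?m" using True by (auto simp: i_def)
            then have "?f Xs $$ (i, j) = count (Xs ! j) x" "?f Ys $$ (i, j) = count (Ys ! j) x"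
              using j len by auto
            then show ?thesis using eq by simp
          next
            case False
            then have "x \<notin># Xs ! j" "x \<notin># Ys ! j"
              using elem[OF X, of "Xs ! j" x] elem[OF Y, of "Ys ! j" x] j len by auto
            then show ?thesis by (simp add: not_in_iff)
          qed
        qed
      qed
    qed
    show "?f ` multiset_lists ?q A = composition_matrices k b"
    proof (intro subset_antisym subsetI)
      fix M assume "M \<in> ?f ` multiset_lists ?q A"
      then obtain Xs where X: "Xs \<in> multiset_lists ?q A" and M: "M = ?f Xs" by auto
      have len: "length Xs = ?q" and sum: "sum_list Xs = A"
        using X by (auto simp: multiset_lists_def)
      have "weak_composition (b ! i) (row M i)" if "i < ?m" for i
        using that count_sum_list_nth[of Xs "i + 2"] cnt[OF that] sum len
        unfolding weak_composition_def M by simp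
      moreover have "(\<Sum>i<?m. M $$ (i, j)) \<ge> 1" if j: "j < ?q" for j
      proof -
        have "Xs ! j \<in> set Xs" "Xs ! j \<noteq> {#}"
          using j len X by (auto simp: multiset_lists_def in_set_conv_nth)
        then obtain x where x: "x \<in># Xs ! j" by blast
        define i where "i = x - 2"
        have xm: "x = i + 2" "i < ?m"
          using elem[OF X \<open>Xs ! j \<in> set Xs\<close> x] by (auto simp: i_def)
        have "1 \<le> M $$ (i, j)" using x xm j unfolding M by (simp add: Suc_le_eq)
        also have "\<dots> \<le> (\<Sum>i<?m. M $$ (i, j))" using xm by (intro member_le_sum) auto
        finally show ?thesis .
      qed
      ultimately show "M \<in> composition_matrices k b"
        unfolding composition_matrices_def M by auto
    next
      fix M assume M: "M \<in> composition_matrices k b"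
      then have dim: "M \<in> carrier_mat ?m ?q"
        and row: "\<And>i. i < ?m \<Longrightarrow> (\<Sum>j<?q. M $$ (i, j)) = b ! i"
        and col: "\<And>j. j < ?q \<Longrightarrow> (\<Sum>i<?m. M $$ (i, j)) \<ge> 1"
        unfolding composition_matrices_def weak_composition_def by auto
      define C where "C j = (\<Sum>i<?m. replicate_mset (M $$ (i, j)) (i + 2))" for j
      have C: "count (C j) x = (if 2 \<le> x \<and> x < ?m + 2 then M $$ (x - 2, j) else 0)" for j x
      proof -
        have "count (C j) x = (\<Sum>i<?m. if i + 2 = x then M $$ (i, j) else 0)"
          unfolding C_def count_sum by (intro sum.cong) auto
        also have "\<dots> = (\<Sum>i<?m. if i = x - 2 then (if 2 \<le> x then M $$ (x - 2, j) else 0) else 0)"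
          by (intro sum.cong) auto
        also have "\<dots> = (if 2 \<le> x \<and> x < ?m + 2 then M $$ (x - 2, j) else 0)"
          by (subst sum.delta) auto
        finally show ?thesis .
      qed
      have "C j \<noteq> {#}" if "j < ?q" for j
      proof
        assume "C j = {#}"
        then have "M $$ (i, j) = 0" if "i < ?m" for i using C[of j "i + 2"] that by simp
        then show False using col[OF that] by simp
      qed
      moreover have "sum_list (map C [0..<?q]) = A"
      proof (rule multiset_eqI)
        fix x
        have "count (sum_list (map C [0..<?q])) x = (\<Sum>j<?q. count (C j) x)"
          by (simp add: count_sum_list_nth)
        also have "\<dots> = count A x"
        proof (cases "2 \<le> x \<and> x < ?m + 2")
          case True
          define i where "i = x - 2"
          have "x = i + 2" "i < ?m" using True by (auto simp: i_def)
          then show ?thesis using row[of i] cnt[of i] by (simp add: C)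
        next
          case False
          then have "x \<notin># A" using supp by auto
          moreover have "count (C j) x = 0" for j using False unfolding C by auto
          ultimately show ?thesis by (simp add: not_in_iff)
        qed
        finally show "count (sum_list (map C [0..<?q])) x = count A x" .
      qed
      ultimately have "map C [0..<?q] \<in> multiset_lists ?q A" by (auto simp: multiset_lists_def)
      moreover have "M = ?f (map C [0..<?q])"
        using dim by (intro eq_matI) (auto simp: C)
      ultimately show "M \<in> ?f ` multiset_lists ?q A" by (rule rev_image_eqI)
    qed
  qed
  then show ?thesis by (rule bij_betw_same_card)
qed

section \<open>Fubini rankings with a given content\<close>

text \<open>Being a Fubini ranking depends on the multiset of letters only, since the condition on a
  letter counts the smaller letters.\<close>

lemma fubini_ranking_iff_mset:
  "fubini_ranking n r \<longleftrightarrow> size (mset r) = n \<and> set_mset (mset r) \<subseteq> {1..n} \<and>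
     (\<forall>x \<in># mset r. x = 1 + size (filter_mset (\<lambda>y. y < x) (mset r)))"
proof -
  have "card {j. j < length r \<and> r ! j < x} = size (filter_mset (\<lambda>y. y < x) (mset r))" for x
    unfolding mset_filter[symmetric] size_mset length_filter_conv_card ..
  then show ?thesis
    unfolding fubini_ranking_def size_mset set_mset_mset all_set_conv_all_nth
    by (cases "length r = n") simp_all
qed

lemma content_determines_mset:
  assumes "set r \<subseteq> {1..n}" "set s \<subseteq> {1..n}"
  shows "content n r = content n s \<longleftrightarrow> mset r = mset s"
proof
  assume eq: "content n r = content n s"
  show "mset r = mset s"
  proof (rule multiset_eqI)
    fix x
    show "count (mset r) x = count (mset s) x"
    proof (cases "x \<in> {1..n}")
      case True
      then show ?thesis using eq by (auto simp: content_def count_mset)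
    next
      case False
      then have "x \<notin> set r" "x \<notin> set s" using assms by auto
      then show ?thesis by (metis count_mset_0_iff)
    qed
  qed
qed (auto simp: content_def simp flip: count_mset)

lemma flattened_rankings_ending_1_eq:
  assumes r: "fubini_ranking n r" and k: "1 \<le> k"
  shows "flattened_rankings_ending_1 n k (content n r) =
           {w \<in> flat_words. mset w = mset r \<and> descents w = k - 1}"
proof (intro subset_antisym subsetI)
  fix w assume "w \<in> flattened_rankings_ending_1 n k (content n r)"
  then have w: "fubini_ranking n w" "content n w = content n r" "weakly_flattened w"
      "card (runs w) = k" "w \<noteq> []" "last w = 1"
    by (auto simp: flattened_rankings_ending_1_def)
  have "mset w = mset r"
    using w(1,2) r content_determines_mset unfolding fubini_ranking_def by blast
  moreover have z: "0 \<notin> set w" using w(1) by (auto simp: fubini_ranking_def)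
  moreover have "descents w = k - 1" using w card_runs by auto
  ultimately show "w \<in> {w \<in> flat_words. mset w = mset r \<and> descents w = k - 1}"
    using w weakly_flattened_iff_descents_to_1[of w] by (auto simp: flat_words_def)
next
  fix w assume "w \<in> {w \<in> flat_words. mset w = mset r \<and> descents w = k - 1}"
  then have w: "w \<in> flat_words" and m: "mset w = mset r" and d: "descents w = k - 1" by auto
  have fw: "fubini_ranking n w" using r unfolding fubini_ranking_iff_mset m .
  moreover have "content n w = content n r"
    using m content_determines_mset fw r unfolding fubini_ranking_def by blast
  moreover have "w \<noteq> []" "last w = 1" using w by (auto simp: flat_words_def)
  moreover have "weakly_flattened w"
    using w weakly_flattened_iff_descents_to_1[of w] by (auto simp: flat_words_def)
  moreover have "card (runs w) = k" using \<open>w \<noteq> []\<close> card_runs d k by simp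
  ultimately show "w \<in> flattened_rankings_ending_1 n k (content n r)"
    by (simp add: flattened_rankings_ending_1_def)
qed

theorem proposition3p11:
  fixes n k :: nat and a :: "nat list"
  assumes "\<exists>r. fubini_ranking n r \<and> content n r = a"
    and "1 \<le> k"
    and "k \<le> a ! 0"
    and "a ! 0 + k \<le> n + 1"
  shows "F n k a = ((a ! 0 - 1) choose (k - 1)) * card (composition_matrices k (tl a))"
proof -
  obtain r where r: "fubini_ranking n r" and a: "content n r = a" using assms(1) by blast
  have n: "n \<ge> 1" using assms(2-4) by linarith
  let ?N = "mset r"
  let ?A = "filter_mset (\<lambda>x. x \<noteq> 1) ?N"
  have sr: "set r \<subseteq> {1..n}" using r by (simp add: fubini_ranking_def)
  have len: "length a = n" using a by (auto simp: content_def)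
  have nth: "a ! i = count ?N (i + 1)" if "i < n" for i
    using that unfolding a[symmetric] content_def by (simp add: count_mset del: upt_Suc)
  have a0: "a ! 0 = count ?N 1" using nth[of 0] n by simp
  have "F n k a = card {w \<in> flat_words. mset w = ?N \<and> descents w = k - 1}"
    unfolding F_def a[symmetric] flattened_rankings_ending_1_eq[OF r assms(2)] ..
  also have "\<dots> = card (compositions (Suc (k - 1)) (count ?N 1) \<times> multiset_lists (k - 1) ?A)"
    by (rule bij_betw_same_card[OF bij_betw_word_of, symmetric]) (use sr in auto)
  also have "\<dots> = ((a ! 0 - 1) choose (k - 1)) * card (multiset_lists (k - 1) ?A)"
    using assms(2,3) by (simp add: card_cartesian_product card_compositions a0)
  also have "card (multiset_lists (k - 1) ?A) = card (composition_matrices k (tl a))"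
  proof (rule card_multiset_lists_eq_card_matrices)
    show "set_mset ?A \<subseteq> {2..<length (tl a) + 2}" using sr len n by fastforce
    show "count ?A (i + 2) = tl a ! i" if "i < length (tl a)" for i
      using that nth[of "Suc i"] len by (simp add: nth_tl)
  qed
  finally show ?thesis .
qed

end
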